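(* Let $\mathcal{L}$ be a non-empty set of lines in $\mathrm{AG}(n,q)$, with $n\geq 4$. Let $3 \leq t\leq n-1$ and suppose that $\mathcal{L}$ restricted to every $t$-dimensional subspace $\pi_i$ defines a Cameron-Liebler line class of parameter $x_{\pi_i}$. Then the following properties are equivalent. \begin{enumerate} \item The set $\mathcal{L}$ is a Cameron-Liebler line class in $\mathrm{AG}(n,q)$ of parameter $C$. \item For every line $\ell$, the number $C:=\frac{q^{t-2}-1}{q^{n-2}-1}\frac{\sum_{\ell \in \pi_i} x_{\pi_i}}{\begin{bmatrix} n-3 \\ t-3\end{bmatrix}_q}-\frac{q^{n-1}-1}{q^{t-1}-1}\chi_\mathcal{L}(\ell)+\chi_\mathcal{L}(\ell)$ is a constant integer independent from $\ell$. Also it holds that through every point at infinity we have exactly $C$ lines of $\mathcal{L}$. \end{enumerate} The sum runs over all $t$-spaces $\pi_i$ through $\ell$.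
   Context: A Cameron-Liebler line class in an affine space $\mathrm{AG}(m,q)$ is a set of lines whose characteristic vector lies in the row space of the point-line incidence matrix of that space; it has parameter $x$ if its size is $x\begin{bmatrix} m \\ 1\end{bmatrix}_q$, where $\begin{bmatrix} b \\ a\end{bmatrix}_q=\frac{(q^b-1)\cdots(q^{b-a+1}-1)}{(q^a-1)\cdots(q-1)}$. Points at infinity refer to the points of the hyperplane at infinity of the projective closure $\mathrm{PG}(n,q)$ of $\mathrm{AG}(n,q)$. $\chi_\mathcal{L}(\ell)$ is $1$ if $\ell\in\mathcal{L}$ and $0$ otherwise. *)

theory Defs
  imports "HOL-Analysis.Analysis"
begin

text \<open>
  The affine space \<open>AG(n,q)\<close> has point set \<^typ>\<open>'k ^ 'n\<close>, where \<open>'k\<close> is a finite field with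
  \<open>CARD('k) = q\<close> and \<open>CARD('n) = n\<close>. A \<open>d\<close>-dimensional affine subspace is identified with the set
  of its points, i.e. with a coset of a \<open>d\<close>-dimensional linear subspace.
\<close>

definition affine_subspace :: "nat \<Rightarrow> ('k::field ^ 'n::finite) set \<Rightarrow> bool" where
  "affine_subspace d S \<longleftrightarrow>
     (\<exists>a W. vec.subspace W \<and> vec.dim W = d \<and> S = (\<lambda>w. a + w) ` W)"

definition lines :: "('k::field ^ 'n::finite) set set" where
  "lines = {l. affine_subspace 1 l}"

definition lines_in :: "('k::field ^ 'n::finite) set \<Rightarrow> ('k ^ 'n) set set" where
  "lines_in \<pi> = {l \<in> lines. l \<subseteq> \<pi>}"

definition gauss_binomial :: "nat \<Rightarrow> nat \<Rightarrow> nat \<Rightarrow> real" where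
  "gauss_binomial q b a =
     (\<Prod>i<a. (real q ^ (b - i) - 1)) / (\<Prod>i<a. (real q ^ (a - i) - 1))"

text \<open>
  The matrix below has a row for every point and a column for every point set of the ambient space.
  Rows of points outside \<open>\<pi>\<close> and columns of sets that are not lines of \<open>\<pi>\<close> are zero; this
  zero-padding of the point-line incidence matrix of \<open>\<pi>\<close> leaves its row space unchanged,
  up to the same padding of the vectors.
\<close>

definition incidence_matrix ::
    "('k::{field,finite} ^ 'n::finite) set \<Rightarrow> real ^ (('k ^ 'n) set) ^ ('k ^ 'n)" where
  "incidence_matrix \<pi> = (\<chi> p l. if p \<in> l \<and> l \<in> lines_in \<pi> then 1 else 0)"

definition characteristic_vector ::
    "('k::{field,finite} ^ 'n::finite) set set \<Rightarrow> real ^ (('k ^ 'n) set)" where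
  "characteristic_vector L = (\<chi> l. if l \<in> L then 1 else 0)"

definition cameron_liebler ::
    "('k::{field,finite} ^ 'n::finite) set \<Rightarrow> ('k ^ 'n) set set \<Rightarrow> bool" where
  "cameron_liebler \<pi> L \<longleftrightarrow>
     L \<subseteq> lines_in \<pi> \<and> characteristic_vector L \<in> span (rows (incidence_matrix \<pi>))"

definition cameron_liebler_of_parameter ::
    "nat \<Rightarrow> ('k::{field,finite} ^ 'n::finite) set \<Rightarrow> ('k ^ 'n) set set \<Rightarrow> real \<Rightarrow> bool" where
  "cameron_liebler_of_parameter m \<pi> L x \<longleftrightarrow>
     affine_subspace m \<pi> \<and> cameron_liebler \<pi> L \<and>
     real (card L) = x * gauss_binomial CARD('k) m 1"

text \<open>
  The projective closure \<open>PG(n,q)\<close> consists of the linear subspaces of \<^typ>\<open>'k ^ 'n option\<close>, the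
  extra homogeneous coordinate being indexed by \<^term>\<open>None\<close>. The affine point \<open>p\<close> corresponds to
  the projective point spanned by \<open>homogenize p\<close>, and the hyperplane at infinity is the one on which
  the extra coordinate vanishes.
\<close>

definition homogenize :: "'k::field ^ 'n::finite \<Rightarrow> 'k ^ 'n option" where
  "homogenize p = (\<chi> i. case i of None \<Rightarrow> 1 | Some j \<Rightarrow> p $ j)"

definition projective_closure :: "('k::field ^ 'n::finite) set \<Rightarrow> ('k ^ 'n option) set" where
  "projective_closure S = vec.span (homogenize ` S)"

definition hyperplane_at_infinity :: "('k::field ^ ('n::finite) option) set" where
  "hyperplane_at_infinity = {v. v $ None = 0}"

definition points_at_infinity :: "('k::field ^ ('n::finite) option) set set" where
  "points_at_infinity = {P. vec.subspace P \<and> vec.dim P = 1 \<and> P \<subseteq> hyperplane_at_infinity}"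

end

theory Submission
  imports Defs
begin

text \<open>
  A vector lies in the row space iff it arises by summing a weight \<open>f\<close> over the points of each line;
  the parameter is then the total weight, because a parallel class partitions the points. The latter
  also shows that every parallel class meets a Cameron-Liebler class in exactly as many lines as its
  parameter. Double counting in the \<open>t\<close>-spaces through a line \<open>l\<close> therefore turns
  \<open>\<Sum> x\<^sub>\<pi>\<close> into a count of the lines of \<open>L\<close> parallel to \<open>l\<close>, so both parts of the second property
  say that every parallel class contains \<open>C\<close> lines of \<open>L\<close>. Conversely, if this holds, the weight
  \<open>f p = (deg p - C) / ([n]\<^sub>q - 1)\<close>, with \<open>deg p\<close> the number of lines of \<open>L\<close> through \<open>p\<close>, works for all
  of \<open>AG(n,q)\<close>: summing the analogous formulas in the \<open>t\<close>-spaces through \<open>l\<close> computes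
  \<open>\<Sum>p\<in>l. deg p\<close>.
\<close>

section \<open>Cardinalities of subspaces over a finite field and Gaussian binomials\<close>

lemma card_field_ge_2: "CARD('k::{field,finite}) \<ge> 2"
proof -
  have "card {0, 1 :: 'k} \<le> CARD('k)" by (rule card_mono) auto
  then show ?thesis by simp
qed

text \<open>Induction on the generators: each vector outside the current span multiplies the
  cardinality by that of the field, because the coefficient of the new vector and the remainder in
  the old span are unique.\<close>

lemma card_span:
  fixes S :: "('k::{field,finite} ^ 'n::finite) set"
  shows "card (vec.span S) = CARD('k) ^ vec.dim S"
proof -
  have "finite S" by simp
  then show ?thesis
  proof (induction S rule: finite_induct)
    case empty
    then show ?case by simp
  next
    case (insert x S)
    show ?case
    proof (cases "x \<in> vec.span S")
      case True
      then show ?thesis using insert.IH by (simp add: vec.span_redundant vec.dim_insert)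
    next
      case False
      let ?f = "\<lambda>(k, w). k *s x + w"
      have inj: "inj_on ?f (UNIV \<times> vec.span S)"
      proof (intro inj_onI; clarify)
        fix k k' and w w' :: "'k ^ 'n"
        assume w: "w \<in> vec.span S" "w' \<in> vec.span S" and eq: "k *s x + w = k' *s x + w'"
        have "(k - k') *s x = w' - w"
          using eq by (simp add: vec.scale_left_diff_distrib algebra_simps)
        then have mem: "(k - k') *s x \<in> vec.span S" using w by (simp add: vec.span_diff)
        have "k = k'"
        proof (rule ccontr)
          assume "k \<noteq> k'"
          then have "inverse (k - k') * (k - k') = 1" by simp
          then have "x = inverse (k - k') *s ((k - k') *s x)" by (metis vec.scale_one vec.scale_scale)
          with mem vec.span_scale have "x \<in> vec.span S" by metis
          with False show False by simp
        qed
        then show "k = k' \<and> w = w'" using eq by simp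
      qed
      have "vec.span (insert x S) = ?f ` (UNIV \<times> vec.span S)"
      proof (intro equalityI subsetI)
        fix v assume "v \<in> vec.span (insert x S)"
        then obtain k where "v - k *s x \<in> vec.span S" by (auto simp: vec.span_breakdown_eq)
        then show "v \<in> ?f ` (UNIV \<times> vec.span S)"
          by (intro image_eqI[of _ _ "(k, v - k *s x)"]) auto
      next
        fix v assume "v \<in> ?f ` (UNIV \<times> vec.span S)"
        then obtain k w where "v = k *s x + w" "w \<in> vec.span S" by auto
        then show "v \<in> vec.span (insert x S)"
          unfolding vec.span_breakdown_eq by (intro exI[of _ k]) simp
      qed
      then have "card (vec.span (insert x S)) = CARD('k) * card (vec.span S)"
        using inj by (simp add: card_image card_cartesian_product)
      then show ?thesis using False insert.IH by (simp add: vec.dim_insert)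
    qed
  qed
qed

lemma card_subspace:
  fixes W :: "('k::{field,finite} ^ 'n::finite) set"
  assumes "vec.subspace W"
  shows "card W = CARD('k) ^ vec.dim W"
  using card_span[of W] assms by (metis vec.span_eq_iff)

lemma gauss_binomial_0 [simp]: "gauss_binomial q b 0 = 1"
  by (simp add: gauss_binomial_def)

lemma gauss_binomial_1: "gauss_binomial q b 1 = (real q ^ b - 1) / (real q - 1)"
  by (simp add: gauss_binomial_def)

text \<open>Splitting off the factors with index 0 shifts both products by one. All ratios of
  Gaussian binomials below come from this recursion.\<close>

lemma gauss_binomial_Suc:
  "gauss_binomial q b (Suc a) =
     gauss_binomial q (b - 1) a * ((real q ^ b - 1) / (real q ^ Suc a - 1))"
  unfolding gauss_binomial_def prod.lessThan_Suc_shift by (simp add: mult.commute)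

lemma gauss_binomial_nonzero:
  assumes "q \<ge> 2" and "a \<le> b"
  shows "gauss_binomial q b a \<noteq> 0"
  using assms(2)
proof (induction a arbitrary: b)
  case (Suc a)
  have "real q ^ m \<noteq> 1" if "m > 0" for m
    using assms(1) one_less_power[of "real q" m] that by force
  with Suc show ?case by (simp add: gauss_binomial_Suc del: power_Suc)
qed simp

text \<open>Counting pairs \<open>(v, W)\<close> with \<open>v \<in> W\<close> outside the span of \<open>S\<close> relates the count for \<open>S\<close> to
  the count for \<open>insert v S\<close>.\<close>

lemma card_subspaces_containing:
  fixes S :: "('k::{field,finite} ^ 'n::finite) set"
  assumes "vec.dim S \<le> t"
  shows "real (card {W. vec.subspace W \<and> vec.dim W = t \<and> S \<subseteq> W}) =
    gauss_binomial CARD('k) (CARD('n) - vec.dim S) (t - vec.dim S)"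
  using assms
proof (induction "t - vec.dim S" arbitrary: S)
  case 0
  then have t: "vec.dim S = t" by simp
  have "{W. vec.subspace W \<and> vec.dim W = t \<and> S \<subseteq> W} = {vec.span S}"
  proof (intro equalityI subsetI; clarsimp)
    fix W :: "('k ^ 'n) set"
    assume W: "vec.subspace W" "S \<subseteq> W" "t = vec.dim W"
    then have "vec.span S \<subseteq> W" by (simp add: vec.span_minimal)
    then show "W = vec.span S"
      using W t vec.subspace_dim_equal[of "vec.span S" W] by simp
  next
    show "vec.dim S = t \<and> S \<subseteq> vec.span S" using t vec.span_superset by blast
  qed
  then show ?case using t by simp
next
  case (Suc a)
  let ?q = "real CARD('k)" and ?d = "vec.dim S"
  define T where "T S = {W. vec.subspace W \<and> vec.dim W = t \<and> S \<subseteq> W}" for S :: "('k ^ 'n) set"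
  have q: "?q > 1" using card_field_ge_2[where 'k='k] by simp
  have dt: "?d < t" and a: "a = t - (?d + 1)" using Suc.hyps(2) by auto
  have dn: "?d \<le> CARD('n)" by (rule dim_subset_UNIV_cart_gen)
  let ?g = "gauss_binomial CARD('k) (CARD('n) - (?d + 1)) (t - (?d + 1))"
  have "real (card (T S)) * (?q ^ t - ?q ^ ?d) = (\<Sum>W\<in>T S. \<Sum>v | v \<in> - vec.span S \<and> v \<in> W. 1)"
  proof -
    have "(\<Sum>v | v \<in> - vec.span S \<and> v \<in> W. 1) = ?q ^ t - ?q ^ ?d" if W: "W \<in> T S" for W
    proof -
      have sub: "vec.span S \<subseteq> W" using W by (simp add: T_def vec.span_minimal)
      have "card W = CARD('k) ^ t" using W by (simp add: T_def card_subspace)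
      moreover have "{v. v \<in> - vec.span S \<and> v \<in> W} = W - vec.span S" by auto
      ultimately show ?thesis
        using sub card_mono[OF _ sub] by (simp add: card_Diff_subset of_nat_diff card_span)
    qed
    then show ?thesis by simp
  qed
  also have "\<dots> = (\<Sum>v\<in>- vec.span S. \<Sum>W | W \<in> T S \<and> v \<in> W. 1)"
    by (rule sum.swap_restrict) simp_all
  also have "\<dots> = (\<Sum>v\<in>- vec.span S. ?g)"
  proof (rule sum.cong[OF refl])
    fix v assume v: "v \<in> - vec.span S"
    have eq: "{W. W \<in> T S \<and> v \<in> W} = T (insert v S)" by (auto simp: T_def)
    have "vec.dim (insert v S) = ?d + 1" using v by (simp add: vec.dim_insert)
    then show "(\<Sum>W | W \<in> T S \<and> v \<in> W. 1) = ?g"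
      unfolding eq using Suc.hyps(1)[of "insert v S"] a dt by (simp add: T_def)
  qed
  also have "\<dots> = (?q ^ CARD('n) - ?q ^ ?d) * ?g"
    by (simp add: Compl_eq_Diff_UNIV card_Diff_subset card_span of_nat_diff
        card_mono dn power_increasing card_field_ge_2[THEN order_trans[rotated]] q[THEN less_imp_le])
  finally have *: "real (card (T S)) * (?q ^ t - ?q ^ ?d) = (?q ^ CARD('n) - ?q ^ ?d) * ?g" .
  \<comment> \<open>Taking out \<open>?q ^ ?d\<close> turns both differences into factors of the
    shape occurring in Gaussian binomials.\<close>
  have f: "?q ^ m - ?q ^ ?d = ?q ^ ?d * (?q ^ (m - ?d) - 1)" if "?d \<le> m" for m
    using that by (simp add: algebra_simps flip: power_add)
  have "real (card (T S)) * (?q ^ (t - ?d) - 1) = (?q ^ (CARD('n) - ?d) - 1) * ?g"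
    using * q dn dt by (simp add: f)
  moreover have "?q ^ (t - ?d) > 1" using q dt by (simp add: one_less_power)
  ultimately have "real (card (T S)) = ?g * ((?q ^ (CARD('n) - ?d) - 1) / (?q ^ (t - ?d) - 1))"
    by (simp add: field_simps)
  also have "\<dots> = gauss_binomial CARD('k) (CARD('n) - ?d) (t - ?d)"
    using gauss_binomial_Suc[of "CARD('k)" "CARD('n) - ?d" a] a Suc.hyps(2)
    by (simp del: power_Suc)
  finally show ?case by (simp add: T_def)
qed

section \<open>Lines given by a point and a direction, and parallel classes\<close>

text \<open>For \<open>d = 0\<close> this degenerates to a single point, hence the side condition
  \<open>d \<noteq> 0\<close> wherever actual lines are meant.\<close>

definition line_through :: "'k::field ^ 'n::finite \<Rightarrow> 'k ^ 'n \<Rightarrow> ('k ^ 'n) set" where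
  "line_through a d = range (\<lambda>c. a + c *s d)"

definition parallel_class :: "'k::field ^ 'n::finite \<Rightarrow> ('k ^ 'n) set set" where
  "parallel_class d = range (\<lambda>a. line_through a d)"

lemma lines_eq: "lines = {line_through a d | a d. d \<noteq> 0}"
proof (intro equalityI subsetI)
  fix l :: "('a ^ 'b) set"
  assume "l \<in> lines"
  then obtain a W where W: "vec.subspace W" "vec.dim W = 1" "l = (\<lambda>w. a + w) ` W"
    unfolding lines_def affine_subspace_def by auto
  then obtain d where d: "d \<in> W" "d \<noteq> 0"
    using vec.dim_eq_0[of W] by fastforce
  have "vec.span {d} = W"
    using vec.subspace_dim_equal[of "vec.span {d}" W] W d vec.span_minimal[of "{d}" W] by simp
  then show "l \<in> {line_through a d | a d. d \<noteq> 0}"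
    using W(3) d(2) by (auto simp: line_through_def vec.span_singleton image_image)
next
  fix l :: "('a ^ 'b) set"
  assume "l \<in> {line_through a d | a d. d \<noteq> 0}"
  then obtain a d where l: "l = line_through a d" and d: "d \<noteq> 0" by auto
  have "l = (\<lambda>w. a + w) ` vec.span {d}"
    by (simp add: l line_through_def vec.span_singleton image_image)
  moreover have "vec.dim (vec.span {d}) = 1" using d by (simp add: vec.dim_span)
  ultimately show "l \<in> lines"
    unfolding lines_def affine_subspace_def using vec.subspace_span by blast
qed

lemma line_through_in_lines: "d \<noteq> 0 \<Longrightarrow> line_through a d \<in> lines"
  by (auto simp: lines_eq)

lemma base_in_line_through: "a \<in> line_through a d"
  by (auto simp: line_through_def intro: image_eqI[of _ _ 0])

lemma line_through_rebase:
  assumes "b \<in> line_through a d"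
  shows "line_through b d = line_through a d"
proof -
  obtain c where b: "b = a + c *s d" using assms by (auto simp: line_through_def)
  have "\<exists>e'. a + c *s d + e *s d = a + e' *s d" for e
    by (rule exI[of _ "c + e"]) (simp add: vec.scale_left_distrib)
  moreover have "\<exists>e'. a + e *s d = a + c *s d + e' *s d" for e
    by (rule exI[of _ "e - c"]) (simp add: vec.scale_left_diff_distrib)
  ultimately show ?thesis unfolding b line_through_def by (auto simp: image_iff)
qed

lemma line_through_scale:
  assumes "c \<noteq> 0"
  shows "line_through a (c *s d) = line_through a d"
proof -
  have "\<exists>e'. e *s d = e' *s (c *s d)" for e
    by (rule exI[of _ "e / c"]) (use assms in \<open>simp add: vec.scale_scale\<close>)
  then show ?thesis unfolding line_through_def by (force simp: image_iff vec.scale_scale)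
qed

text \<open>Seen from \<open>p\<close>, the point \<open>r\<close> differs by a nonzero multiple of
  \<open>d\<close>, and scaling the direction does not change the line.\<close>

lemma line_through_direction:
  assumes "p \<in> line_through a d" and "r \<in> line_through a d" and "p \<noteq> r"
  shows "line_through a d = line_through p (r - p)"
proof -
  have "r \<in> line_through p d" using assms line_through_rebase by blast
  then obtain c where c: "r = p + c *s d" by (auto simp: line_through_def)
  with assms(3) have "c \<noteq> 0" by auto
  then show ?thesis
    using c line_through_rebase[OF assms(1)] by (simp add: line_through_scale)
qed

lemma line_through_points:
  assumes "p \<noteq> r"
  shows "{l \<in> lines. p \<in> l \<and> r \<in> l} = {line_through p (r - p)}"
proof -
  have "r \<in> line_through p (r - p)"
    by (auto simp: line_through_def image_iff intro: exI[of _ 1])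
  moreover have "l = line_through p (r - p)" if "l \<in> lines" "p \<in> l" "r \<in> l" for l
    using that assms line_through_direction[of p _ _ r] unfolding lines_eq by blast
  moreover have "p \<in> line_through p (r - p)" by (rule base_in_line_through)
  moreover have "line_through p (r - p) \<in> lines" using assms by (simp add: line_through_in_lines)
  ultimately show ?thesis by blast
qed

lemma card_line_through:
  fixes a d :: "'k::{field,finite} ^ 'n::finite"
  assumes "d \<noteq> 0"
  shows "card (line_through a d) = CARD('k)"
  unfolding line_through_def using assms
  by (intro card_image injI) (auto simp: vec.scale_right_imp_eq)

lemma card_line: "l \<in> lines \<Longrightarrow> card (l :: ('k::{field,finite} ^ 'n::finite) set) = CARD('k)"
  by (auto simp: lines_eq card_line_through)

section \<open>Affine subspaces and the lines they contain\<close>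

text \<open>Translating by an element of \<open>W\<close> maps \<open>W\<close> onto itself, so any
  point can serve as the origin. This reduces affine questions to linear ones.\<close>

lemma affine_subspace_rebase:
  assumes "affine_subspace t \<pi>" and "p \<in> \<pi>"
  obtains W where "vec.subspace W" "vec.dim W = t" "\<pi> = (\<lambda>w. p + w) ` W"
proof -
  obtain a W where W: "vec.subspace W" "vec.dim W = t" "\<pi> = (\<lambda>w. a + w) ` W"
    using assms(1) by (auto simp: affine_subspace_def)
  obtain w where w: "w \<in> W" "p = a + w" using assms(2) W by auto
  have "\<exists>u\<in>W. a + v = p + u" if "v \<in> W" for v
    by (rule bexI[of _ "v - w"]) (use w that W(1) vec.subspace_diff in auto)
  moreover have "\<exists>u\<in>W. p + v = a + u" if "v \<in> W" for v
    by (rule bexI[of _ "w + v"]) (use w that W(1) vec.subspace_add in auto)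
  ultimately have "\<pi> = (\<lambda>w. p + w) ` W" using W(3) by (auto simp: image_iff)
  with W that show ?thesis by blast
qed

text \<open>The parameters 0 and 1 place \<open>u\<close> and \<open>u + d\<close> in
  \<open>W\<close>, hence also their difference; closure of \<open>W\<close> gives the
  converse.\<close>

lemma line_through_subset_iff:
  assumes "vec.subspace W"
  shows "line_through (p + u) d \<subseteq> (\<lambda>w. p + w) ` W \<longleftrightarrow> u \<in> W \<and> d \<in> W"
proof
  assume sub: "line_through (p + u) d \<subseteq> (\<lambda>w. p + w) ` W"
  have "p + u + c *s d \<in> (\<lambda>w. p + w) ` W" for c
    using sub by (auto simp: line_through_def)
  from this[of 0] this[of 1] have "u \<in> W" "u + d \<in> W" by (auto simp: add.assoc)
  then show "u \<in> W \<and> d \<in> W" using assms vec.subspace_diff by fastforce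
next
  assume "u \<in> W \<and> d \<in> W"
  then have "u + c *s d \<in> W" for c
    using assms by (simp add: vec.subspace_add vec.subspace_scale)
  then show "line_through (p + u) d \<subseteq> (\<lambda>w. p + w) ` W"
    by (auto simp: line_through_def add.assoc)
qed

lemma line_through_subset_affine_subspace:
  assumes "affine_subspace t \<pi>" and "a \<in> \<pi>" and "p \<in> \<pi>" and "line_through a d \<subseteq> \<pi>"
  shows "line_through p d \<subseteq> \<pi>"
proof -
  obtain W where W: "vec.subspace W" "\<pi> = (\<lambda>w. a + w) ` W"
    using affine_subspace_rebase[OF assms(1,2)] by metis
  from assms(3) W(2) obtain u where u: "u \<in> W" "p = a + u" by auto
  show ?thesis
    using line_through_subset_iff[OF W(1), of a 0 d] line_through_subset_iff[OF W(1), of a u d]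
      assms(4) W(2) u by auto
qed

lemma line_through_points_subset_affine_subspace:
  assumes "affine_subspace t \<pi>" and "p \<in> \<pi>" and "r \<in> \<pi>"
  shows "line_through p (r - p) \<subseteq> \<pi>"
proof -
  obtain W where W: "vec.subspace W" "\<pi> = (\<lambda>w. p + w) ` W"
    using affine_subspace_rebase[OF assms(1,2)] by metis
  from assms(3) W(2) have "r - p \<in> W" by auto
  then show ?thesis
    using line_through_subset_iff[OF W(1), of p 0 "r - p"] W vec.subspace_0[OF W(1)] by simp
qed

lemma affine_subspace_UNIV: "affine_subspace CARD('n) (UNIV :: ('k::field ^ 'n::finite) set)"
  unfolding affine_subspace_def
  by (rule exI[of _ 0], rule exI[of _ UNIV]) (simp add: vec_dim_card del: vec.dim_UNIV)

lemma card_affine_subspace: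
  fixes \<pi> :: "('k::{field,finite} ^ 'n::finite) set"
  assumes "affine_subspace t \<pi>"
  shows "card \<pi> = CARD('k) ^ t"
  using assms by (auto simp: affine_subspace_def card_image card_subspace)

section \<open>Counting affine subspaces through one line or two coplanar lines\<close>

text \<open>Translation by \<open>p\<close> is a bijection from the linear subspaces containing
  \<open>S\<close>. The inserted \<open>0\<close> forces \<open>p\<close> itself to lie in
  \<open>\<pi>\<close>.\<close>

lemma card_affine_subspaces_containing:
  fixes S :: "('k::{field,finite} ^ 'n::finite) set"
  assumes "vec.dim S \<le> t"
  shows "real (card {\<pi>. affine_subspace t \<pi> \<and> (\<lambda>w. p + w) ` insert 0 S \<subseteq> \<pi>}) =
    gauss_binomial CARD('k) (CARD('n) - vec.dim S) (t - vec.dim S)"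
proof -
  let ?T = "{W. vec.subspace W \<and> vec.dim W = t \<and> S \<subseteq> W}"
  have "{\<pi>. affine_subspace t \<pi> \<and> (\<lambda>w. p + w) ` insert 0 S \<subseteq> \<pi>} = (\<lambda>W. (\<lambda>w. p + w) ` W) ` ?T"
  proof (intro equalityI subsetI)
    fix \<pi> assume \<pi>: "\<pi> \<in> {\<pi>. affine_subspace t \<pi> \<and> (\<lambda>w. p + w) ` insert 0 S \<subseteq> \<pi>}"
    then have "affine_subspace t \<pi>" "p \<in> \<pi>" by auto
    then obtain W where W: "vec.subspace W" "vec.dim W = t" "\<pi> = (\<lambda>w. p + w) ` W"
      by (rule affine_subspace_rebase)
    with \<pi> have "S \<subseteq> W" by auto
    with W show "\<pi> \<in> (\<lambda>W. (\<lambda>w. p + w) ` W) ` ?T" by auto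
  next
    fix \<pi> assume "\<pi> \<in> (\<lambda>W. (\<lambda>w. p + w) ` W) ` ?T"
    then show "\<pi> \<in> {\<pi>. affine_subspace t \<pi> \<and> (\<lambda>w. p + w) ` insert 0 S \<subseteq> \<pi>}"
      using vec.subspace_0 by (auto simp: affine_subspace_def)
  qed
  moreover have "inj_on (\<lambda>W. (\<lambda>w. p + w) ` W) ?T"
    by (intro inj_onI) (metis add_left_cancel inj_image_eq_iff injI)
  ultimately show ?thesis using card_subspaces_containing[OF assms] by (simp add: card_image)
qed

lemma card_affine_subspaces_containing_line:
  fixes l :: "('k::{field,finite} ^ 'n::finite) set"
  assumes "l \<in> lines" and "1 \<le> t"
  shows "real (card {\<pi>. affine_subspace t \<pi> \<and> l \<subseteq> \<pi>}) =
    gauss_binomial CARD('k) (CARD('n) - 1) (t - 1)"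
proof -
  obtain a d where l: "l = line_through a d" and d: "d \<noteq> 0" using assms(1) by (auto simp: lines_eq)
  have "l \<subseteq> \<pi> \<longleftrightarrow> (\<lambda>w. a + w) ` insert 0 {d} \<subseteq> \<pi>" if "affine_subspace t \<pi>" for \<pi>
  proof -
    have "a \<in> l" "a + d \<in> l"
      using base_in_line_through by (auto simp: l line_through_def image_iff intro: exI[of _ 1])
    moreover have "l \<subseteq> \<pi>" if "a \<in> \<pi>" "a + d \<in> \<pi>"
      using line_through_points_subset_affine_subspace[OF \<open>affine_subspace t \<pi>\<close> that] l by simp
    ultimately show ?thesis by auto
  qed
  then have "{\<pi>. affine_subspace t \<pi> \<and> l \<subseteq> \<pi>} =
      {\<pi>. affine_subspace t \<pi> \<and> (\<lambda>w. a + w) ` insert 0 {d} \<subseteq> \<pi>}" by blast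
  then show ?thesis using card_affine_subspaces_containing[of "{d}" t a] assms(2) d by simp
qed

text \<open>The two ways in which distinct lines share a plane, meeting (\<open>a = b\<close>) or
  being parallel (\<open>d = e\<close>), are treated together, since both occur in the double
  counts. Equal lines are allowed.\<close>

definition coplanar_lines :: "('k::field ^ 'n::finite) set \<Rightarrow> ('k ^ 'n) set \<Rightarrow> bool" where
  "coplanar_lines l l' \<longleftrightarrow>
     (\<exists>a b d e. l = line_through a d \<and> l' = line_through b e \<and> d \<noteq> 0 \<and> e \<noteq> 0 \<and> (a = b \<or> d = e))"

text \<open>Distinct lines that meet or are parallel span a plane, so containing both amounts to
  containing one point and a direction space of dimension 2.\<close>

lemma card_affine_subspaces_containing_coplanar_lines:
  fixes l :: "('k::{field,finite} ^ 'n::finite) set"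
  assumes "coplanar_lines l l'" and "l \<noteq> l'" and "2 \<le> t"
  shows "real (card {\<pi>. affine_subspace t \<pi> \<and> l \<subseteq> \<pi> \<and> l' \<subseteq> \<pi>}) =
    gauss_binomial CARD('k) (CARD('n) - 2) (t - 2)"
proof -
  obtain a b d e where l: "l = line_through a d" and l': "l' = line_through b e"
    and nz: "d \<noteq> 0" "e \<noteq> 0" and or: "a = b \<or> d = e"
    using assms(1) unfolding coplanar_lines_def by blast
  \<comment> \<open>Together with \<open>d\<close> this spans the direction space of the plane: for
    concurrent lines it is the second direction, for parallel ones a vector joining the
    lines.\<close>
  define u where "u = (if a = b then e else b - a)"
  \<comment> \<open>Dependence would make the two lines coincide.\<close>
  have u: "u \<notin> vec.span {d}"
  proof
    assume "u \<in> vec.span {d}"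
    then obtain c where c: "u = c *s d" by (auto simp: vec.span_singleton)
    show False
    proof (cases "a = b")
      case True
      with c nz u_def have "c \<noteq> 0" "e = c *s d" by auto
      with True l l' assms(2) show False by (simp add: line_through_scale)
    next
      case False
      with c u_def have "b = a + c *s d" by (simp add: algebra_simps)
      then have "b \<in> line_through a d" by (auto simp: line_through_def)
      with False or l l' assms(2) show False using line_through_rebase by metis
    qed
  qed
  then have dim: "vec.dim {u, d} = 2" using nz by (simp add: vec.dim_insert)
  have "l \<subseteq> \<pi> \<and> l' \<subseteq> \<pi> \<longleftrightarrow> (\<lambda>w. a + w) ` insert 0 {u, d} \<subseteq> \<pi>" if \<pi>: "affine_subspace t \<pi>" for \<pi>
  proof (cases "a \<in> \<pi>")
    case True
    then obtain W where W: "vec.subspace W" "\<pi> = (\<lambda>w. a + w) ` W"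
      using affine_subspace_rebase[OF \<pi>] by metis
    have "l \<subseteq> \<pi> \<longleftrightarrow> d \<in> W"
      using line_through_subset_iff[OF W(1), of a 0 d] vec.subspace_0[OF W(1)] l W(2) by simp
    moreover have "l' \<subseteq> \<pi> \<longleftrightarrow> b - a \<in> W \<and> e \<in> W"
      using line_through_subset_iff[OF W(1), of a "b - a" e] l' W(2) by simp
    moreover have "(\<lambda>w. a + w) ` insert 0 {u, d} \<subseteq> \<pi> \<longleftrightarrow> u \<in> W \<and> d \<in> W"
      using vec.subspace_0[OF W(1)] W(2) by auto
    ultimately show ?thesis
      using or vec.subspace_0[OF W(1)] by (auto simp: u_def)
  next
    case False
    then show ?thesis using base_in_line_through[of a d] l by auto
  qed
  then have "{\<pi>. affine_subspace t \<pi> \<and> l \<subseteq> \<pi> \<and> l' \<subseteq> \<pi>} =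
      {\<pi>. affine_subspace t \<pi> \<and> (\<lambda>w. a + w) ` insert 0 {u, d} \<subseteq> \<pi>}" by blast
  then show ?thesis
    using card_affine_subspaces_containing[of "{u, d}" t a] dim assms(3) by simp
qed

text \<open>After exchanging the sums, \<open>l\<close> itself contributes \<open>?N1\<close> if it
  is in \<open>M\<close>, and every other line of \<open>M\<close> contributes \<open>?N2\<close>.
  \<open>M\<close> will be the part of \<open>L\<close> in a parallel class or through a
  point.\<close>

lemma sum_card_affine_subspaces_containing:
  fixes l :: "('k::{field,finite} ^ 'n::finite) set"
  assumes "l \<in> lines" and "2 \<le> t" and "\<And>l'. l' \<in> M \<Longrightarrow> coplanar_lines l l'"
  shows "(\<Sum>\<pi> | affine_subspace t \<pi> \<and> l \<subseteq> \<pi>. real (card {l' \<in> M. l' \<subseteq> \<pi>})) =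
    indicator M l * gauss_binomial CARD('k) (CARD('n) - 1) (t - 1) +
    (real (card M) - indicator M l) * gauss_binomial CARD('k) (CARD('n) - 2) (t - 2)"
    (is "_ = _ * ?N1 + _ * ?N2")
proof -
  have "(\<Sum>\<pi> | affine_subspace t \<pi> \<and> l \<subseteq> \<pi>. real (card {l' \<in> M. l' \<subseteq> \<pi>})) =
      (\<Sum>\<pi> | affine_subspace t \<pi> \<and> l \<subseteq> \<pi>. \<Sum>l' | l' \<in> M \<and> l' \<subseteq> \<pi>. 1)" by simp
  also have "\<dots> = (\<Sum>l'\<in>M. \<Sum>\<pi> | \<pi> \<in> {\<pi>. affine_subspace t \<pi> \<and> l \<subseteq> \<pi>} \<and> l' \<subseteq> \<pi>. 1)"
    by (rule sum.swap_restrict) simp_all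
  also have "\<dots> = (\<Sum>l'\<in>M. (if l' = l then ?N1 - ?N2 else 0) + ?N2)"
    using card_affine_subspaces_containing_line[OF assms(1)] assms(2)
      card_affine_subspaces_containing_coplanar_lines[OF assms(3)]
    by (intro sum.cong) (auto simp: conj_assoc)
  also have "\<dots> = (if l \<in> M then ?N1 - ?N2 else 0) + real (card M) * ?N2"
    by (simp add: sum.distrib)
  finally show ?thesis by (simp add: algebra_simps indicator_def)
qed

lemma coplanar_parallel_class:
  "d \<noteq> 0 \<Longrightarrow> l' \<in> parallel_class d \<Longrightarrow> coplanar_lines (line_through a d) l'"
  by (auto simp: coplanar_lines_def parallel_class_def)

lemma coplanar_concurrent:
  assumes "l \<in> lines" and "l' \<in> lines" and "p \<in> l" and "p \<in> l'"
  shows "coplanar_lines l l'"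
proof -
  have "\<exists>d. d \<noteq> 0 \<and> m = line_through p d" if "m \<in> lines" "p \<in> m" for m
    using that by (auto simp: lines_eq dest: line_through_rebase[symmetric])
  with assms show ?thesis unfolding coplanar_lines_def by metis
qed

section \<open>Incidences inside an affine subspace\<close>

lemma lines_in_through_points:
  assumes \<pi>: "affine_subspace t \<pi>" and p: "p \<in> \<pi>" and r: "r \<in> \<pi>" and ne: "p \<noteq> r"
  shows "{l \<in> lines_in \<pi>. p \<in> l \<and> r \<in> l} = {line_through p (r - p)}"
proof -
  have "{l \<in> lines_in \<pi>. p \<in> l \<and> r \<in> l} = {l \<in> lines. p \<in> l \<and> r \<in> l} \<inter> {l. l \<subseteq> \<pi>}"
    unfolding lines_in_def by blast
  then show ?thesis
    unfolding line_through_points[OF ne]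
    using line_through_points_subset_affine_subspace[OF \<pi> p r] by blast
qed

text \<open>The lines through \<open>p\<close> partition the other points of \<open>\<pi>\<close>
  into sets of size \<open>?q - 1\<close>.\<close>

lemma card_lines_containing_point:
  fixes \<pi> :: "('k::{field,finite} ^ 'n::finite) set"
  assumes \<pi>: "affine_subspace t \<pi>" and p: "p \<in> \<pi>"
  shows "real (card {l \<in> lines_in \<pi>. p \<in> l}) = gauss_binomial CARD('k) t 1"
proof -
  let ?A = "{l \<in> lines_in \<pi>. p \<in> l}" and ?q = "CARD('k)"
  have q: "?q \<ge> 2" by (rule card_field_ge_2)
  have "(\<Sum>l\<in>?A. \<Sum>r | r \<in> \<pi> - {p} \<and> r \<in> l. 1 :: real) =
      (\<Sum>r\<in>\<pi> - {p}. \<Sum>l | l \<in> ?A \<and> r \<in> l. 1)"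
    by (rule sum.swap_restrict) simp_all
  moreover have "(\<Sum>r | r \<in> \<pi> - {p} \<and> r \<in> l. 1 :: real) = real ?q - 1" if "l \<in> ?A" for l
  proof -
    have "{r. r \<in> \<pi> - {p} \<and> r \<in> l} = l - {p}" using that by (auto simp: lines_in_def)
    then show ?thesis
      using that card_line[of l] q by (simp add: lines_in_def of_nat_diff)
  qed
  moreover have "(\<Sum>l | l \<in> ?A \<and> r \<in> l. 1 :: real) = 1" if "r \<in> \<pi> - {p}" for r
  proof -
    have "{l. l \<in> ?A \<and> r \<in> l} = {l \<in> lines_in \<pi>. p \<in> l \<and> r \<in> l}" by blast
    also have "\<dots> = {line_through p (r - p)}"
      using that by (intro lines_in_through_points[OF \<pi> p]) auto
    finally show ?thesis by simp
  qed
  ultimately have "real (card ?A) * (real ?q - 1) = real (card (\<pi> - {p}))" by simp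
  also have "\<dots> = real ?q ^ t - 1"
    using p q by (simp add: card_affine_subspace[OF \<pi>] of_nat_diff)
  finally show ?thesis using q unfolding gauss_binomial_1 by (simp add: field_simps)
qed

section \<open>The row space as point weights, and the parameter as total weight\<close>

text \<open>Coefficients are indexed by row indices, not by elements of the set
  \<open>rows A\<close>, in which equal rows (such as the zero rows of the padding) are
  merged.\<close>

lemma span_rows_iff:
  fixes A :: "real ^ 'm::finite ^ 'r::finite"
  shows "v \<in> span (rows A) \<longleftrightarrow> (\<exists>f. v = (\<Sum>i\<in>UNIV. f i *\<^sub>R row i A))"
proof
  let ?R = "range (\<lambda>f. \<Sum>i\<in>UNIV. f i *\<^sub>R row i A)"
  have "subspace ?R"
  proof (rule subspaceI)
    show "0 \<in> ?R" by (rule image_eqI[of _ _ "\<lambda>_. 0"]) auto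
  next
    fix u v assume "u \<in> ?R" "v \<in> ?R"
    then obtain f g where "u = (\<Sum>i\<in>UNIV. f i *\<^sub>R row i A)" "v = (\<Sum>i\<in>UNIV. g i *\<^sub>R row i A)" by auto
    then show "u + v \<in> ?R"
      by (intro image_eqI[of _ _ "\<lambda>i. f i + g i"]) (auto simp: scaleR_left_distrib sum.distrib)
  next
    fix c u assume "u \<in> ?R"
    then obtain f where "u = (\<Sum>i\<in>UNIV. f i *\<^sub>R row i A)" by auto
    then show "c *\<^sub>R u \<in> ?R"
      by (intro image_eqI[of _ _ "\<lambda>i. c * f i"]) (auto simp: scaleR_sum_right)
  qed
  moreover have "rows A \<subseteq> ?R"
  proof
    fix r assume "r \<in> rows A"
    then obtain j where "r = row j A" by (auto simp: rows_def)
    then show "r \<in> ?R"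
      by (intro image_eqI[of _ _ "\<lambda>i. if i = j then 1 else 0"]) (auto simp: if_distrib[of "\<lambda>c. c *\<^sub>R _"] cong: if_cong)
  qed
  ultimately have "span (rows A) \<subseteq> ?R" by (rule span_minimal[rotated])
  then show "v \<in> span (rows A) \<Longrightarrow> \<exists>f. v = (\<Sum>i\<in>UNIV. f i *\<^sub>R row i A)" by auto
next
  assume v: "\<exists>f. v = (\<Sum>i\<in>UNIV. f i *\<^sub>R row i A)"
  have "row i A \<in> span (rows A)" for i by (rule span_base) (auto simp: rows_def)
  with v show "v \<in> span (rows A)" by (auto intro: span_sum span_scale)
qed

text \<open>The weight \<open>f p\<close> is the coefficient of row \<open>p\<close>. In columns
  that are not lines of \<open>\<pi>\<close> both vectors vanish, so only
  \<open>lines_in \<pi>\<close> matters.\<close>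

lemma cameron_liebler_iff:
  "cameron_liebler \<pi> L \<longleftrightarrow>
     L \<subseteq> lines_in \<pi> \<and> (\<exists>f :: _ \<Rightarrow> real. \<forall>l \<in> lines_in \<pi>. (\<Sum>p\<in>l. f p) = indicator L l)"
proof -
  have "characteristic_vector L = (\<Sum>p\<in>UNIV. f p *\<^sub>R row p (incidence_matrix \<pi>)) \<longleftrightarrow>
      (\<forall>l \<in> lines_in \<pi>. (\<Sum>p\<in>l. f p) = indicator L l)" if "L \<subseteq> lines_in \<pi>" for f
  proof -
    have "(\<Sum>p\<in>UNIV. f p *\<^sub>R row p (incidence_matrix \<pi>)) $ l =
        (if l \<in> lines_in \<pi> then \<Sum>p\<in>l. f p else 0)" for l
    proof -
      have "(\<Sum>p\<in>UNIV. f p * (if p \<in> l \<and> l \<in> lines_in \<pi> then 1 else 0)) =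
          (\<Sum>p\<in>UNIV. if p \<in> l then (if l \<in> lines_in \<pi> then f p else 0) else 0)"
        by (intro sum.cong) auto
      then show ?thesis
        by (simp add: row_def incidence_matrix_def sum.If_cases)
    qed
    then show ?thesis
      using that by (auto simp: vec_eq_iff characteristic_vector_def indicator_def split: if_splits)
  qed
  then show ?thesis unfolding cameron_liebler_def span_rows_iff by blast
qed

text \<open>The common double count, applied below to all lines, to a parallel class and to the
  lines through a point.\<close>

lemma sum_lines_in:
  fixes \<pi> :: "('k::{field,finite} ^ 'n::finite) set" and f :: "'k ^ 'n \<Rightarrow> real"
  assumes "A \<subseteq> lines_in \<pi>"
  shows "(\<Sum>l\<in>A. \<Sum>p\<in>l. f p) = (\<Sum>p\<in>\<pi>. real (card {l \<in> A. p \<in> l}) * f p)"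
proof -
  have "(\<Sum>l\<in>A. \<Sum>p\<in>l. f p) = (\<Sum>l\<in>A. \<Sum>p | p \<in> \<pi> \<and> p \<in> l. f p)"
    using assms by (intro sum.cong) (auto simp: lines_in_def)
  also have "\<dots> = (\<Sum>p\<in>\<pi>. \<Sum>l | l \<in> A \<and> p \<in> l. f p)"
    by (rule sum.swap_restrict) simp_all
  finally show ?thesis by simp
qed

text \<open>Summing the weight equations over all lines counts every point
  \<open>gauss_binomial CARD('k) m 1\<close> times. For \<open>m \<ge> 1\<close> this number is
  nonzero and can be cancelled.\<close>

lemma cameron_liebler_of_parameter_iff:
  fixes \<pi> :: "('k::{field,finite} ^ 'n::finite) set"
  assumes "m \<ge> 1"
  shows "cameron_liebler_of_parameter m \<pi> L x \<longleftrightarrow>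
     affine_subspace m \<pi> \<and> L \<subseteq> lines_in \<pi> \<and>
     (\<exists>f. (\<forall>l \<in> lines_in \<pi>. (\<Sum>p\<in>l. f p) = indicator L l) \<and> x = (\<Sum>p\<in>\<pi>. f p))"
proof -
  have "real (card L) = x * gauss_binomial CARD('k) m 1 \<longleftrightarrow> x = (\<Sum>p\<in>\<pi>. f p)"
    if \<pi>: "affine_subspace m \<pi>" and L: "L \<subseteq> lines_in \<pi>"
      and f: "\<forall>l \<in> lines_in \<pi>. (\<Sum>p\<in>l. f p) = indicator L l" for f
  proof -
    have "real (card L) = (\<Sum>l\<in>lines_in \<pi>. indicator L l)"
      using L by (simp add: indicator_def sum.If_cases Int_absorb1)
    also have "\<dots> = (\<Sum>p\<in>\<pi>. real (card {l \<in> lines_in \<pi>. p \<in> l}) * f p)"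
      using f by (simp flip: sum_lines_in)
    also have "\<dots> = (\<Sum>p\<in>\<pi>. f p) * gauss_binomial CARD('k) m 1"
      using card_lines_containing_point[OF \<pi>]
      by (simp add: sum_distrib_right mult.commute)
    finally show ?thesis
      using gauss_binomial_nonzero[OF card_field_ge_2, of 1 m] assms by auto
  qed
  then show ?thesis
    unfolding cameron_liebler_of_parameter_def cameron_liebler_iff by blast
qed

lemma parallel_class_partition:
  assumes \<pi>: "affine_subspace t \<pi>" and sub: "line_through a d \<subseteq> \<pi>" and p: "p \<in> \<pi>"
  shows "{l \<in> parallel_class d. l \<subseteq> \<pi> \<and> p \<in> l} = {line_through p d}"
proof -
  have "line_through p d \<subseteq> \<pi>"
    using line_through_subset_affine_subspace[OF \<pi> _ p sub] sub base_in_line_through[of a d] by blast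
  moreover have "l = line_through p d" if "l \<in> parallel_class d" "p \<in> l" for l
    using that by (auto simp: parallel_class_def dest: line_through_rebase)
  moreover have "line_through p d \<in> parallel_class d" by (simp add: parallel_class_def)
  ultimately show ?thesis using base_in_line_through[of p d] by blast
qed

lemma parallel_class_subset_lines: "d \<noteq> 0 \<Longrightarrow> parallel_class d \<subseteq> lines"
  by (auto simp: parallel_class_def line_through_in_lines)

text \<open>The lines of one direction partition \<open>\<pi>\<close>, so adding their weight
  equations counts every point once.\<close>

lemma sum_eq_card_parallel:
  fixes \<pi> :: "('k::{field,finite} ^ 'n::finite) set"
  assumes \<pi>: "affine_subspace t \<pi>" and sub: "line_through a d \<subseteq> \<pi>" and d: "d \<noteq> 0"
    and f: "\<forall>l \<in> lines_in \<pi>. (\<Sum>p\<in>l. f p) = indicator L l"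
  shows "(\<Sum>p\<in>\<pi>. f p) = real (card {l \<in> L \<inter> parallel_class d. l \<subseteq> \<pi>})"
proof -
  let ?A = "{l \<in> parallel_class d. l \<subseteq> \<pi>}"
  have A: "?A \<subseteq> lines_in \<pi>" using parallel_class_subset_lines[OF d] by (auto simp: lines_in_def)
  have "(\<Sum>p\<in>\<pi>. f p) = (\<Sum>p\<in>\<pi>. real (card {l \<in> ?A. p \<in> l}) * f p)"
    using parallel_class_partition[OF \<pi> sub] by (simp add: conj_assoc)
  also have "\<dots> = (\<Sum>l\<in>?A. indicator L l)"
    using f A by (subst sum_lines_in[symmetric]) (auto intro!: sum.cong)
  also have "\<dots> = real (card (?A \<inter> L))"
    by (simp add: indicator_def sum.If_cases)
  also have "?A \<inter> L = {l \<in> L \<inter> parallel_class d. l \<subseteq> \<pi>}" by auto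
  finally show ?thesis .
qed

text \<open>Adding the weight equations of the lines through \<open>p\<close> counts
  \<open>p\<close> once per line and every other point once. Solved for \<open>f p\<close>, this
  suggests the weight used for the converse.\<close>

lemma card_through_point_eq:
  fixes \<pi> :: "('k::{field,finite} ^ 'n::finite) set"
  assumes \<pi>: "affine_subspace t \<pi>" and p: "p \<in> \<pi>"
    and f: "\<forall>l \<in> lines_in \<pi>. (\<Sum>r\<in>l. f r) = indicator L l"
  shows "real (card {l \<in> L \<inter> lines_in \<pi>. p \<in> l}) =
    (gauss_binomial CARD('k) t 1 - 1) * f p + (\<Sum>r\<in>\<pi>. f r)"
proof -
  let ?A = "{l \<in> lines_in \<pi>. p \<in> l}" and ?g = "gauss_binomial CARD('k) t 1"
  have eq: "{l \<in> L \<inter> lines_in \<pi>. p \<in> l} = ?A \<inter> L" by auto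
  have "real (card (?A \<inter> L)) = (\<Sum>l\<in>?A. indicator L l)"
    by (simp add: indicator_def sum.If_cases)
  also have "\<dots> = (\<Sum>l\<in>?A. \<Sum>r\<in>l. f r)"
    using f by (auto intro!: sum.cong)
  also have "\<dots> = (\<Sum>r\<in>\<pi>. real (card {l \<in> ?A. r \<in> l}) * f r)"
    by (rule sum_lines_in) auto
  also have "\<dots> = (\<Sum>r\<in>\<pi>. (if r = p then (?g - 1) * f r else 0) + f r)"
  proof (rule sum.cong[OF refl])
    fix r assume r: "r \<in> \<pi>"
    show "real (card {l \<in> ?A. r \<in> l}) * f r = (if r = p then (?g - 1) * f r else 0) + f r"
    proof (cases "r = p")
      case True
      then have "{l \<in> ?A. r \<in> l} = ?A" by auto
      then show ?thesis
        using card_lines_containing_point[OF \<pi> p] True by (simp add: algebra_simps)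
    next
      case False
      have "{l \<in> ?A. r \<in> l} = {l \<in> lines_in \<pi>. p \<in> l \<and> r \<in> l}" by blast
      also have "\<dots> = {line_through p (r - p)}"
        using False by (intro lines_in_through_points[OF \<pi> p r]) simp
      finally show ?thesis using False by simp
    qed
  qed
  also have "\<dots> = (?g - 1) * f p + (\<Sum>r\<in>\<pi>. f r)"
    using p by (simp add: sum.distrib)
  finally show ?thesis unfolding eq .
qed

section \<open>Points at infinity correspond to parallel classes\<close>

text \<open>This is the difference of the homogenized points \<open>a + d\<close> and
  \<open>a\<close>, for any \<open>a\<close>.\<close>

definition direction_at_infinity :: "'k::field ^ 'n::finite \<Rightarrow> 'k ^ 'n option" where
  "direction_at_infinity d = (\<chi> i. case i of None \<Rightarrow> 0 | Some j \<Rightarrow> d $ j)"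

lemma points_at_infinity_eq:
  "points_at_infinity = {vec.span {direction_at_infinity d} | d. d \<noteq> 0}"
proof (intro equalityI subsetI)
  fix P :: "('a ^ 'b option) set"
  assume "P \<in> points_at_infinity"
  then have P: "vec.subspace P" "vec.dim P = 1" "P \<subseteq> hyperplane_at_infinity"
    by (auto simp: points_at_infinity_def)
  then obtain v where v: "v \<in> P" "v \<noteq> 0"
    using vec.dim_eq_0[of P] by fastforce
  define d where "d = (\<chi> j. v $ Some j)"
  have vd: "v = direction_at_infinity d"
    using v(1) P(3) by (auto simp: vec_eq_iff direction_at_infinity_def d_def
        hyperplane_at_infinity_def split: option.splits)
  have "vec.span {v} = P"
    using vec.subspace_dim_equal[of "vec.span {v}" P] P v vec.span_minimal[of "{v}" P] by simp
  moreover have "d \<noteq> 0"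
    using v(2) by (auto simp: vd direction_at_infinity_def vec_eq_iff split: option.splits)
  ultimately show "P \<in> {vec.span {direction_at_infinity d} | d. d \<noteq> 0}" using vd by blast
next
  fix P :: "('a ^ 'b option) set"
  assume "P \<in> {vec.span {direction_at_infinity d} | d. d \<noteq> 0}"
  then obtain d where P: "P = vec.span {direction_at_infinity d}" and d: "d \<noteq> 0" by blast
  obtain j where "d $ j \<noteq> 0" using d by (auto simp: vec_eq_iff)
  then have "direction_at_infinity d $ Some j \<noteq> 0" by (simp add: direction_at_infinity_def)
  then have "direction_at_infinity d \<noteq> 0" by (metis zero_index)
  then have "vec.dim P = 1" by (simp add: P)
  moreover have "P \<subseteq> hyperplane_at_infinity"
    by (auto simp: P vec.span_singleton hyperplane_at_infinity_def direction_at_infinity_def)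
  ultimately show "P \<in> points_at_infinity"
    by (simp add: P points_at_infinity_def)
qed

text \<open>The closure of a line lies in the span of a homogenized point and its direction at
  infinity, so its vectors at infinity are multiples of that direction.\<close>

lemma direction_subset_projective_closure_iff:
  assumes "l \<in> lines" and "e \<noteq> 0"
  shows "vec.span {direction_at_infinity e} \<subseteq> projective_closure l \<longleftrightarrow> l \<in> parallel_class e"
proof
  obtain a d where l: "l = line_through a d" and d: "d \<noteq> 0" using assms(1) by (auto simp: lines_eq)
  let ?a = "homogenize a" and ?d = "direction_at_infinity d"
  assume "vec.span {direction_at_infinity e} \<subseteq> projective_closure l"
  then have "direction_at_infinity e \<in> vec.span (homogenize ` l)"
    unfolding projective_closure_def using vec.span_base by blast
  moreover have "homogenize ` l \<subseteq> vec.span {?a, ?d}"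
  proof
    fix v assume "v \<in> homogenize ` l"
    then obtain c where "v = homogenize (a + c *s d)" by (auto simp: l line_through_def)
    then have "v = ?a + c *s ?d"
      by (auto simp: vec_eq_iff homogenize_def direction_at_infinity_def split: option.splits)
    then show "v \<in> vec.span {?a, ?d}"
      by (simp add: vec.span_add vec.span_scale vec.span_base)
  qed
  ultimately have "direction_at_infinity e \<in> vec.span {?a, ?d}"
    using vec.span_minimal[OF _ vec.subspace_span] by blast
  then obtain k c where eq: "direction_at_infinity e - k *s ?a = c *s ?d"
    by (auto simp: vec.span_breakdown_eq vec.span_singleton)
  \<comment> \<open>The coordinate \<open>None\<close> is 1 in \<open>?a\<close> and 0 in both
    directions, so it reads off \<open>k\<close>.\<close>
  have "k = 0"
    using arg_cong[OF eq, of "\<lambda>v. v $ None"] by (simp add: homogenize_def direction_at_infinity_def)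
  have e: "e = c *s d"
  proof (rule vec_eq_iff[THEN iffD2], rule allI)
    fix j show "e $ j = (c *s d) $ j"
      using arg_cong[OF eq, of "\<lambda>v. v $ Some j"] \<open>k = 0\<close>
      by (simp add: homogenize_def direction_at_infinity_def)
  qed
  with assms(2) have "c \<noteq> 0" by auto
  with l e have "l = line_through a e" by (simp add: line_through_scale)
  then show "l \<in> parallel_class e" by (simp add: parallel_class_def)
next
  assume "l \<in> parallel_class e"
  then obtain a where l: "l = line_through a e" by (auto simp: parallel_class_def)
  have "a \<in> l" "a + e \<in> l"
    using base_in_line_through by (auto simp: l line_through_def image_iff intro: exI[of _ 1])
  then have "homogenize (a + e) - homogenize a \<in> projective_closure l"
    unfolding projective_closure_def by (intro vec.span_diff vec.span_base) auto
  moreover have "homogenize (a + e) - homogenize a = direction_at_infinity e"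
    by (auto simp: vec_eq_iff homogenize_def direction_at_infinity_def split: option.splits)
  ultimately show "vec.span {direction_at_infinity e} \<subseteq> projective_closure l"
    unfolding projective_closure_def by (simp add: vec.span_minimal)
qed

section \<open>Double counts over the t-spaces through a line\<close>

lemma gauss_binomial_1_diff:
  assumes "q \<ge> 2" and "m \<ge> 1"
  shows "gauss_binomial q m 1 - 1 = real q * (real q ^ (m - 1) - 1) / (real q - 1)"
proof -
  have "real q ^ m = real q * real q ^ (m - 1)"
    using assms(2) power_Suc[of "real q" "m - 1"] by simp
  then show ?thesis using assms(1) unfolding gauss_binomial_1 by (simp add: field_simps)
qed

text \<open>Each \<open>x \<pi>\<close> counts the lines of \<open>L\<close> in \<open>\<pi>\<close>
  parallel to \<open>l\<close>, so the sum counts pairs of such a line and a t-space containing it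
  and \<open>l\<close>.\<close>

lemma sum_parameters_through_line:
  fixes L :: "('k::{field,finite} ^ 'n::finite) set set" and a d :: "'k ^ 'n"
  assumes cl: "\<And>\<pi>. affine_subspace t \<pi> \<Longrightarrow>
      cameron_liebler_of_parameter t \<pi> {l \<in> L. l \<subseteq> \<pi>} (x \<pi>)"
    and t: "2 \<le> t" and d: "d \<noteq> 0"
  defines "l \<equiv> line_through a d"
  shows "(\<Sum>\<pi> | affine_subspace t \<pi> \<and> l \<subseteq> \<pi>. x \<pi>) =
    indicator L l * gauss_binomial CARD('k) (CARD('n) - 1) (t - 1) +
    (real (card (L \<inter> parallel_class d)) - indicator L l) *
      gauss_binomial CARD('k) (CARD('n) - 2) (t - 2)"
proof -
  let ?M = "L \<inter> parallel_class d"
  have "x \<pi> = real (card {m \<in> ?M. m \<subseteq> \<pi>})" if \<pi>: "affine_subspace t \<pi>" and sub: "l \<subseteq> \<pi>" for \<pi>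
  proof -
    obtain f where f: "\<forall>m \<in> lines_in \<pi>. (\<Sum>p\<in>m. f p) = indicator {l \<in> L. l \<subseteq> \<pi>} m"
        and x: "x \<pi> = (\<Sum>p\<in>\<pi>. f p)"
      using cl[OF \<pi>] t cameron_liebler_of_parameter_iff[of t \<pi> "{l \<in> L. l \<subseteq> \<pi>}" "x \<pi>"] by auto
    have "{m \<in> {l \<in> L. l \<subseteq> \<pi>} \<inter> parallel_class d. m \<subseteq> \<pi>} = {m \<in> ?M. m \<subseteq> \<pi>}" by blast
    then show ?thesis
      using sum_eq_card_parallel[OF \<pi> sub[unfolded l_def] d f] x by metis
  qed
  then have "(\<Sum>\<pi> | affine_subspace t \<pi> \<and> l \<subseteq> \<pi>. x \<pi>) =
      (\<Sum>\<pi> | affine_subspace t \<pi> \<and> l \<subseteq> \<pi>. real (card {m \<in> ?M. m \<subseteq> \<pi>}))"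
    by (intro sum.cong) auto
  also have "\<dots> = indicator ?M l * gauss_binomial CARD('k) (CARD('n) - 1) (t - 1) +
      (real (card ?M) - indicator ?M l) * gauss_binomial CARD('k) (CARD('n) - 2) (t - 2)"
    using d t by (intro sum_card_affine_subspaces_containing)
      (auto simp: l_def line_through_in_lines intro: coplanar_parallel_class)
  also have "indicator ?M l = (indicator L l :: real)"
    by (simp add: indicator_def l_def parallel_class_def)
  finally show ?thesis .
qed

text \<open>For points \<open>p\<close> of \<open>l\<close> and t-spaces \<open>\<pi>\<close>
  through \<open>l\<close>, the lines of \<open>L\<close> in \<open>\<pi>\<close> through
  \<open>p\<close> are summed in two orders: for fixed \<open>p\<close> by the count of t-spaces,
  for fixed \<open>\<pi>\<close> by the local weights.\<close>

lemma sum_degrees_on_line: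
  fixes L :: "('k::{field,finite} ^ 'n::finite) set set"
  assumes cl: "\<And>\<pi>. affine_subspace t \<pi> \<Longrightarrow>
      cameron_liebler_of_parameter t \<pi> {l \<in> L. l \<subseteq> \<pi>} (x \<pi>)"
    and L: "L \<subseteq> lines" and t: "2 \<le> t" and l: "l \<in> lines"
  defines "N1 \<equiv> gauss_binomial CARD('k) (CARD('n) - 1) (t - 1)"
    and "N2 \<equiv> gauss_binomial CARD('k) (CARD('n) - 2) (t - 2)"
  shows "(\<Sum>p\<in>l. indicator L l * N1 + (real (card {m \<in> L. p \<in> m}) - indicator L l) * N2) =
    (gauss_binomial CARD('k) t 1 - 1) * indicator L l * N1 +
    real CARD('k) * (\<Sum>\<pi> | affine_subspace t \<pi> \<and> l \<subseteq> \<pi>. x \<pi>)"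
proof -
  let ?T = "{\<pi>. affine_subspace t \<pi> \<and> l \<subseteq> \<pi>}" and ?g = "gauss_binomial CARD('k) t 1 - 1"
  let ?M = "\<lambda>p. {m \<in> L. p \<in> m}"
  have "(\<Sum>p\<in>l. real (card {m \<in> ?M p. m \<subseteq> \<pi>})) = ?g * indicator L l + real CARD('k) * x \<pi>"
    if "\<pi> \<in> ?T" for \<pi>
  proof -
    from that have \<pi>: "affine_subspace t \<pi>" and sub: "l \<subseteq> \<pi>" by auto
    let ?L = "{l \<in> L. l \<subseteq> \<pi>}"
    obtain f where f: "\<forall>m \<in> lines_in \<pi>. (\<Sum>p\<in>m. f p) = indicator ?L m"
        and x: "x \<pi> = (\<Sum>p\<in>\<pi>. f p)"
      using cl[OF \<pi>] t cameron_liebler_of_parameter_iff[of t \<pi> ?L "x \<pi>"] by auto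
    have "(\<Sum>p\<in>l. real (card {m \<in> ?M p. m \<subseteq> \<pi>})) = (\<Sum>p\<in>l. ?g * f p + x \<pi>)"
    proof (rule sum.cong[OF refl])
      fix p assume "p \<in> l"
      then have p: "p \<in> \<pi>" using sub by auto
      have eq: "{m \<in> ?M p. m \<subseteq> \<pi>} = {m \<in> ?L \<inter> lines_in \<pi>. p \<in> m}"
        using L unfolding lines_in_def by blast
      show "real (card {m \<in> ?M p. m \<subseteq> \<pi>}) = ?g * f p + x \<pi>"
        unfolding eq x by (rule card_through_point_eq[OF \<pi> p f])
    qed
    also have "\<dots> = ?g * (\<Sum>p\<in>l. f p) + real CARD('k) * x \<pi>"
      by (simp add: sum.distrib card_line[OF l] flip: sum_distrib_left)
    \<comment> \<open>The weight depends on \<open>\<pi>\<close>, but its sum over \<open>l\<close>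
      does not; this eliminates the local weights.\<close>
    also have "(\<Sum>p\<in>l. f p) = indicator L l"
      using f l sub by (simp add: lines_in_def indicator_def)
    finally show ?thesis .
  qed
  then have "(\<Sum>\<pi>\<in>?T. \<Sum>p\<in>l. real (card {m \<in> ?M p. m \<subseteq> \<pi>})) =
      (\<Sum>\<pi>\<in>?T. ?g * indicator L l + real CARD('k) * x \<pi>)"
    by (intro sum.cong) auto
  also have "\<dots> = real (card ?T) * (?g * indicator L l) + real CARD('k) * (\<Sum>\<pi>\<in>?T. x \<pi>)"
    by (simp add: sum.distrib sum_distrib_left)
  also have "real (card ?T) = N1"
    unfolding N1_def using card_affine_subspaces_containing_line[OF l] t by simp
  finally have "(\<Sum>p\<in>l. \<Sum>\<pi>\<in>?T. real (card {m \<in> ?M p. m \<subseteq> \<pi>})) =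
      ?g * indicator L l * N1 + real CARD('k) * (\<Sum>\<pi>\<in>?T. x \<pi>)"
    by (subst sum.swap) (simp add: mult_ac)
  moreover have "(\<Sum>\<pi>\<in>?T. real (card {m \<in> ?M p. m \<subseteq> \<pi>})) =
      indicator L l * N1 + (real (card (?M p)) - indicator L l) * N2" if p: "p \<in> l" for p
  proof -
    have "coplanar_lines l m" if "m \<in> ?M p" for m
      using that L p coplanar_concurrent[OF l] by blast
    moreover have "indicator (?M p) l = (indicator L l :: real)"
      using p by (simp add: indicator_def)
    ultimately show ?thesis
      using sum_card_affine_subspaces_containing[OF l t, of "?M p"] unfolding N1_def N2_def by simp
  qed
  ultimately show ?thesis by (simp cong: sum.cong)
qed

section \<open>Reduction of all conditions to the sizes of parallel classes in
  \<open>L\<close>\<close>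

theorem theorem5p6:
  fixes L :: "('k::{field,finite} ^ 'n::finite) set set"
    and x :: "('k ^ 'n) set \<Rightarrow> real"
    and C :: real
    and q n t :: nat
  assumes "q = CARD('k)" and "n = CARD('n)"
    and "n \<ge> 4" and "3 \<le> t" and "t \<le> n - 1"
    and "L \<subseteq> lines" and "L \<noteq> {}"
    and "\<And>\<pi>. affine_subspace t \<pi> \<Longrightarrow>
           cameron_liebler_of_parameter t \<pi> {l \<in> L. l \<subseteq> \<pi>} (x \<pi>)"
  shows "cameron_liebler_of_parameter n UNIV L C \<longleftrightarrow>
     C \<in> \<int> \<and>
     (\<forall>l \<in> lines.
        C = (real q ^ (t - 2) - 1) / (real q ^ (n - 2) - 1)
              * ((\<Sum>\<pi> | affine_subspace t \<pi> \<and> l \<subseteq> \<pi>. x \<pi>) / gauss_binomial q (n - 3) (t - 3))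
            - (real q ^ (n - 1) - 1) / (real q ^ (t - 1) - 1) * indicator L l
            + indicator L l) \<and>
     (\<forall>P \<in> points_at_infinity.
        real (card {l \<in> L. P \<subseteq> projective_closure l}) = C)"
proof -
  note q = assms(1) and n = assms(2) and cl = assms(8) and L = assms(6)
  let ?F = "\<lambda>d. real (card (L \<inter> parallel_class d))"
  let ?S = "\<lambda>l. \<Sum>\<pi> | affine_subspace t \<pi> \<and> l \<subseteq> \<pi>. x \<pi>"
  \<comment> \<open>\<open>N1\<close> and \<open>N2\<close> count the t-spaces through one line and
    through two distinct coplanar lines; \<open>r\<close> will be their ratio.\<close>
  define N1 where "N1 = gauss_binomial q (n - 1) (t - 1)"
  define N2 where "N2 = gauss_binomial q (n - 2) (t - 2)"
  define r where "r = (real q ^ (n - 1) - 1) / (real q ^ (t - 1) - 1)"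
  define E where "E l = (real q ^ (t - 2) - 1) / (real q ^ (n - 2) - 1)
      * (?S l / gauss_binomial q (n - 3) (t - 3)) - r * indicator L l + indicator L l" for l
  have q2: "q \<ge> 2" unfolding q by (rule card_field_ge_2)
  have pow: "real q ^ m > 1" if "m > 0" for m
    using q2 that by (intro one_less_power) auto
  have N2_nz: "N2 \<noteq> 0" unfolding N2_def using q2 assms(3-5) by (intro gauss_binomial_nonzero) auto
  have N1: "N1 = N2 * r"
    using gauss_binomial_Suc[of q "n - 1" "t - 2"] assms(4)
    by (simp add: N1_def N2_def r_def Suc_diff_le numeral_2_eq_2 numeral_3_eq_3 Suc_diff_Suc del: power_Suc)
  \<comment> \<open>The prefactor and the Gaussian binomial in the second property thus combine to
    division by \<open>N2\<close>.\<close>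
  have N2: "N2 = gauss_binomial q (n - 3) (t - 3) * ((real q ^ (n - 2) - 1) / (real q ^ (t - 2) - 1))"
    using gauss_binomial_Suc[of q "n - 2" "t - 3"] assms(4)
    by (simp add: N2_def Suc_diff_le numeral_2_eq_2 numeral_3_eq_3 Suc_diff_Suc del: power_Suc)
  have S: "?S (line_through a d) = indicator L (line_through a d) * N1 +
      (?F d - indicator L (line_through a d)) * N2" if "d \<noteq> 0" for a d
    using sum_parameters_through_line[OF cl _ that, where a = a] assms(4)
    by (simp add: N1_def N2_def q n)
  \<comment> \<open>Dividing \<open>S\<close> by \<open>N2\<close> leaves \<open>?F d\<close> plus
    \<open>r - 1\<close> times the indicator, which is exactly what \<open>E\<close>
    subtracts.\<close>
  have E: "E (line_through a d) = ?F d" if "d \<noteq> 0" for a d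
  proof -
    have eq: "E l = ?S l / N2 - r * indicator L l + indicator L l" for l
      unfolding E_def N2 by (simp add: mult_ac)
    show ?thesis
      unfolding eq S[OF that] N1 using N2_nz by (simp add: field_simps)
  qed
  have lines_E: "(\<forall>l \<in> lines. C = E l) \<longleftrightarrow> (\<forall>d. d \<noteq> 0 \<longrightarrow> ?F d = C)"
  proof
    assume H: "\<forall>l \<in> lines. C = E l"
    show "\<forall>d. d \<noteq> 0 \<longrightarrow> ?F d = C"
      using H line_through_in_lines[of _ 0] E[of _ 0] by metis
  next
    assume "\<forall>d. d \<noteq> 0 \<longrightarrow> ?F d = C"
    then show "\<forall>l \<in> lines. C = E l" using E by (auto simp: lines_eq)
  qed
  have infinity: "(\<forall>P \<in> points_at_infinity. real (card {l \<in> L. P \<subseteq> projective_closure l}) = C) \<longleftrightarrow>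
      (\<forall>d. d \<noteq> 0 \<longrightarrow> ?F d = C)"
  proof -
    have "{l \<in> L. vec.span {direction_at_infinity d} \<subseteq> projective_closure l} = L \<inter> parallel_class d"
      if "d \<noteq> 0" for d
      using L direction_subset_projective_closure_iff[OF _ that] by blast
    then show ?thesis unfolding points_at_infinity_eq by auto
  qed
  \<comment> \<open>Any nonzero direction would do; it exhibits \<open>C\<close> as a
    cardinality.\<close>
  define d0 :: "'k ^ 'n" where "d0 = axis undefined 1"
  have d0: "d0 \<noteq> 0" by (simp add: d0_def axis_eq_0_iff)
  have integer: "C \<in> \<int>" if "\<forall>d. d \<noteq> 0 \<longrightarrow> ?F d = C"
  proof -
    have "C = ?F d0" using that d0 by simp
    then show ?thesis by simp
  qed
  have "n \<ge> 1" using assms(3) by simp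
  note iff = cameron_liebler_of_parameter_iff[OF this, of "UNIV :: ('k ^ 'n) set" L C]
  have UNIV: "affine_subspace n (UNIV :: ('k ^ 'n) set)" unfolding n by (rule affine_subspace_UNIV)
  have lines_UNIV: "lines_in UNIV = lines" by (simp add: lines_in_def)
  have sum_f: "(\<Sum>p\<in>UNIV. f p) = ?F d"
    if "\<forall>l \<in> lines_in UNIV. (\<Sum>p\<in>l. f p) = indicator L l" "d \<noteq> 0" for f d
    using sum_eq_card_parallel[OF UNIV _ that(2,1)] by (simp add: Int_def)
  have main: "cameron_liebler_of_parameter n UNIV L C \<longleftrightarrow> (\<forall>d. d \<noteq> 0 \<longrightarrow> ?F d = C)"
  proof
    assume "cameron_liebler_of_parameter n UNIV L C"
    then show "\<forall>d. d \<noteq> 0 \<longrightarrow> ?F d = C" unfolding iff using sum_f by metis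
  next
    assume F: "\<forall>d. d \<noteq> 0 \<longrightarrow> ?F d = C"
    define g where "g m = gauss_binomial q m 1 - 1" for m
    \<comment> \<open>The ratio \<open>r\<close> of \<open>N1\<close> to \<open>N2\<close> reappears
      here as that of the coefficients \<open>g\<close>; this agreement makes the global weight
      work.\<close>
    have gn: "g n = r * g t"
      using gauss_binomial_1_diff[OF q2, of n] gauss_binomial_1_diff[OF q2, of t] assms(3,4)
        pow[of "t - 1"] unfolding g_def r_def by simp
    have "real q ^ (n - 1) > 1" using assms(3) by (intro pow) simp
    then have "real q ^ (n - 1) - 1 \<noteq> 0" by linarith
    then have "g n \<noteq> 0"
      unfolding g_def gauss_binomial_1_diff[OF q2 \<open>n \<ge> 1\<close>] using q2
      unfolding divide_eq_0_iff mult_eq_0_iff by simp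
    \<comment> \<open>This solves \<open>card_through_point_eq\<close> for the weight in the whole
      space, with total weight \<open>C\<close>.\<close>
    define f where "f p = (real (card {m \<in> L. p \<in> m}) - C) / g n" for p
    have f: "(\<Sum>p\<in>l. f p) = indicator L l" if l: "l \<in> lines" for l
    proof -
      let ?D = "\<Sum>p\<in>l. real (card {m \<in> L. p \<in> m})" and ?c = "indicator L l :: real"
      have "?S l = ?c * N1 + (C - ?c) * N2" using l F S by (auto simp: lines_eq)
      moreover have "real q * (?c * N1) + (?D - real q * ?c) * N2 = g t * ?c * N1 + real q * ?S l"
        using sum_degrees_on_line[OF cl L _ l] assms(4) card_line[OF l]
        by (simp add: sum.distrib sum_subtractf g_def N1_def N2_def q n flip: sum_distrib_right)
      ultimately have "real q * (?c * N1) + (?D - real q * ?c) * N2 =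
          g t * ?c * N1 + real q * (?c * N1 + (C - ?c) * N2)" by simp
      \<comment> \<open>The terms with factor \<open>real q * ?c\<close> cancel on both
        sides.\<close>
      then have "(?D - real q * C) * N2 = g t * ?c * N1" by (simp add: algebra_simps)
      then have "?D - real q * C = ?c * g n" using N2_nz by (simp add: N1 gn)
      then show ?thesis
        using \<open>g n \<noteq> 0\<close> card_line[OF l]
        by (simp add: f_def sum_subtractf q flip: sum_divide_distrib)
    qed
    \<comment> \<open>The total weight equals the size of the class of \<open>d0\<close> in
      \<open>L\<close>, so the parameter is \<open>C\<close>.\<close>
    then have "C = (\<Sum>p\<in>UNIV. f p)" using sum_f[of f d0] d0 F by (simp add: lines_UNIV)
    with f show "cameron_liebler_of_parameter n UNIV L C"
      unfolding iff using UNIV L by (auto simp: lines_UNIV)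
  qed
  show ?thesis
    unfolding infinity lines_E[unfolded E_def r_def] main using integer by blast
qed

end
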